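(* Let $\mu$ be a probability measure on $\mathbb{R}$ with compact support such that its logarithmic potential $U_\mu(x)=-\int\ln|x-y|\,d\mu(y)$ exists and is continuous on $\mathbb{C}$. Then there exists a (finite) constant $B_\mu$ such that, for any probability measure $\nu$ on $\mathbb{R}$, $$W_1^2(\nu,\mu)\le B_\mu\,\Sigma_\mu(\nu).$$
   Context: $W_1(\mu,\nu)=\inf_\pi\int_{\mathbb{R}^2}|x-y|\,d\pi(x,y)$, the infimum being over couplings $\pi$ with marginals $\mu,\nu$; $W_1^2$ denotes its square. Let $S_\mu$ denote the support of $\mu$. For a compactly supported $\mu$ with continuous logarithmic potential, the free entropy relative to $\mu$ is $$\Sigma_\mu(\nu)=-\iint_{\mathbb{R}^2}\ln|x-y|\,d(\nu-\mu)(x)\,d(\nu-\mu)(y)$$ if the probability measure $\nu$ has support included in $S_\mu$ (this takes values in $[0,+\infty]$, being $+\infty$ when $\iint\ln|x-y|\,d\nu(x)\,d\nu(y)=-\infty$), and $\Sigma_\mu(\nu)=+\infty$ otherwise. *)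

theory Defs
  imports "HOL-Probability.Probability"
begin

definition measure_support :: "'a::topological_space measure \<Rightarrow> 'a set" where
  "measure_support M = {x. \<forall>U. open U \<longrightarrow> x \<in> U \<longrightarrow> emeasure M U \<noteq> 0}"

(* Integral of an extended-real function as positive part minus negative part
   (e2ennreal truncates negative values to 0).  It is the usual integral, possibly
   infinite, whenever at most one part is infinite; if both are, the value is
   \<infinity> - \<infinity> = \<infinity>. *)
definition ereal_integral :: "'a measure \<Rightarrow> ('a \<Rightarrow> ereal) \<Rightarrow> ereal" where
  "ereal_integral M f =
     enn2ereal (\<integral>\<^sup>+x. e2ennreal (f x) \<partial>M) - enn2ereal (\<integral>\<^sup>+x. e2ennreal (- f x) \<partial>M)"

(* The real-valued ln has ln 0 = 0, which would be wrong on the diagonal x = y. *)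
definition ereal_ln :: "real \<Rightarrow> ereal" where
  "ereal_ln t = (if t = 0 then - \<infinity> else ereal (ln t))"

definition log_potential :: "real measure \<Rightarrow> complex \<Rightarrow> ereal" where
  "log_potential \<mu> z = - ereal_integral \<mu> (\<lambda>y. ereal_ln (norm (z - of_real y)))"

definition log_integral :: "real measure \<Rightarrow> real measure \<Rightarrow> ereal" where
  "log_integral \<mu> \<nu> = ereal_integral (\<mu> \<Otimes>\<^sub>M \<nu>) (\<lambda>(x, y). ereal_ln \<bar>x - y\<bar>)"

(* The integral against the signed measure (\<nu> - \<mu>) \<otimes> (\<nu> - \<mu>) is the signed sum of its
   four parts.  If \<mu> has compact support and continuous (finite) potential and the support
   of \<nu> is in that of \<mu>, all of them are finite except that the first may be -\<infinity>. *)
definition relative_free_entropy :: "real measure \<Rightarrow> real measure \<Rightarrow> ereal" where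
  "relative_free_entropy \<mu> \<nu> =
     (if measure_support \<nu> \<subseteq> measure_support \<mu>
      then - (log_integral \<nu> \<nu> - log_integral \<nu> \<mu> - log_integral \<mu> \<nu> + log_integral \<mu> \<mu>)
      else \<infinity>)"

definition couplings :: "real measure \<Rightarrow> real measure \<Rightarrow> (real \<times> real) measure set" where
  "couplings \<mu> \<nu> =
     {\<pi>. sets \<pi> = sets borel \<and> distr \<pi> borel fst = \<mu> \<and> distr \<pi> borel snd = \<nu>}"

definition W1 :: "real measure \<Rightarrow> real measure \<Rightarrow> ennreal" where
  "W1 \<mu> \<nu> = (INF \<pi>\<in>couplings \<mu> \<nu>. \<integral>\<^sup>+p. ennreal \<bar>fst p - snd p\<bar> \<partial>\<pi>)"

end

(* On [-R, R] put L = 2 R. For |t| <= L,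
     - ln |t| = 1 - ln L - |t| / L + k(t),   k(t) = int_0^L s^(-2) max(s - |t|, 0) ds,
   and max(s - |x - y|, 0) is the integral over u of the product of the indicators of
   (u, u + s] at x and at y, so the kernel k is positive definite. Integrating against the
   square of \<nu> - \<mu>, the constant disappears and the kernel - |x - y| contributes
   2 int (F_\<nu> - F_\<mu>)^2, whence the free entropy is at least (1 / R) int (F_\<nu> - F_\<mu>)^2.
   The quantile coupling gives W_1 <= int |F_\<nu> - F_\<mu>|, and by Cauchy-Schwarz the constant
   2 R^2 works. The potential is used only to make the energies involving \<mu> finite. *)
theory Submission
  imports Defs
begin

section \<open>Supports and extended-real integrals\<close>

text \<open>Every point outside the support has an open null neighbourhood, which can be shrunk to a
  member of a countable basis. The complement of the support is thus covered by countably many null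
  sets.\<close>

lemma AE_in_measure_support:
  fixes M :: "real measure"
  assumes M: "sets M = sets borel"
  shows "AE x in M. x \<in> measure_support M"
proof -
  obtain B :: "real set set" where B: "countable B" "topological_basis B"
    using ex_countable_basis by auto
  let ?N = "{b \<in> B. emeasure M b = 0}"
  have "countable ?N"
    by (rule countable_subset[OF _ B(1)]) blast
  then have "(\<Union>b\<in>?N. b) \<in> null_sets M"
  proof (rule null_sets_UN')
    fix b assume "b \<in> ?N"
    then show "b \<in> null_sets M"
      using topological_basis_open[OF B(2)] M by (simp add: null_sets_def)
  qed
  then have N: "\<Union>?N \<in> null_sets M"
    by simp
  have "x \<in> measure_support M" if "x \<notin> \<Union>?N" for x
    unfolding measure_support_def
  proof (intro CollectI allI impI notI)
    fix U assume U: "open U" "x \<in> U" "emeasure M U = 0"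
    obtain b where b: "b \<in> B" "x \<in> b" "b \<subseteq> U"
      by (rule topological_basisE[OF B(2) U(1,2)])
    have "emeasure M b \<le> emeasure M U"
      using emeasure_mono[OF b(3), of M] U(1) M by simp
    then have "b \<in> ?N"
      using U(3) b(1) by simp
    then show False
      using b(2) that by blast
  qed
  then show ?thesis
    by (intro AE_I'[OF N]) blast
qed

(* Moving all negative terms to the other side turns f = g - h into an identity of
   nonnegative functions, which can be integrated even where h is infinite. *)
lemma ereal_integral_diff:
  fixes g :: "'a \<Rightarrow> real" and h :: "'a \<Rightarrow> ennreal"
  assumes g: "integrable M g" and h [measurable]: "h \<in> borel_measurable M"
    and f: "AE x in M. f x = ereal (g x) - enn2ereal (h x)"
  shows "ereal_integral M f = ereal (\<integral>x. g x \<partial>M) - enn2ereal (\<integral>\<^sup>+x. h x \<partial>M)"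
proof -
  have [measurable]: "g \<in> borel_measurable M"
    using g by auto
  let ?f = "\<lambda>x. ereal (g x) - enn2ereal (h x)"
  define p where "p = (\<integral>\<^sup>+x. e2ennreal (?f x) \<partial>M)"
  define n where "n = (\<integral>\<^sup>+x. e2ennreal (- ?f x) \<partial>M)"
  define a where "a = (\<integral>\<^sup>+x. ennreal (g x) \<partial>M)"
  define b where "b = (\<integral>\<^sup>+x. ennreal (- g x) \<partial>M)"
  define H where "H = (\<integral>\<^sup>+x. h x \<partial>M)"
  have ab: "a < \<infinity>" "b < \<infinity>" "(\<integral>x. g x \<partial>M) = enn2real a - enn2real b"
    using g by (auto simp: a_def b_def real_integrable_def real_lebesgue_integral_def less_top)
  have "p \<le> a"
    unfolding p_def a_def
  proof (intro nn_integral_mono)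
    fix x
    show "e2ennreal (?f x) \<le> ennreal (g x)"
      by (cases "h x") (auto simp: e2ennreal_neg ennreal.rep_eq intro: ennreal_leI)
  qed
  have "p + (H + b) = n + a"
  proof -
    have "p + (H + b) = (\<integral>\<^sup>+x. e2ennreal (?f x) + (h x + ennreal (- g x)) \<partial>M)"
      unfolding p_def H_def b_def by (simp add: nn_integral_add)
    also have "\<dots> = (\<integral>\<^sup>+x. e2ennreal (- ?f x) + ennreal (g x) \<partial>M)"
    proof (intro nn_integral_cong)
      fix x
      show "e2ennreal (?f x) + (h x + ennreal (- g x)) = e2ennreal (- ?f x) + ennreal (g x)"
      proof (cases "h x")
        case (real r)
        then show ?thesis
          by (cases "g x \<ge> r"; cases "g x \<ge> 0")
            (auto simp: ennreal_neg ennreal_plus[symmetric] simp del: ennreal_plus)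
      qed auto
    qed
    also have "\<dots> = n + a"
      unfolding n_def a_def by (simp add: nn_integral_add)
    finally show ?thesis .
  qed
  moreover have "ereal_integral M f = enn2ereal p - enn2ereal n"
    unfolding ereal_integral_def p_def n_def
    using f by (intro arg_cong2[where f = minus] arg_cong[where f = enn2ereal] nn_integral_cong_AE) auto
  \<comment> \<open>With \<open>p\<close>, \<open>a\<close> and \<open>b\<close> finite, the balance
    \<open>p + (H + b) = n + a\<close> forces \<open>H\<close> and \<open>n\<close> to be infinite
    together, and then both sides of the claim are minus infinity. Otherwise the balance is one
    between real numbers.\<close>
  moreover have "p < \<infinity>"
    using \<open>p \<le> a\<close> ab(1) by (rule le_less_trans)
  ultimately show ?thesis
    unfolding ab H_def[symmetric]
    using ab(1,2)
    by (cases p; cases a; cases b; cases H; cases n)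
      (auto simp: ennreal_plus[symmetric] simp del: ennreal_plus)
qed

section \<open>Product kernels and positive definiteness of the window kernel\<close>

text \<open>Tonelli, applied twice to move the parameter \<open>p\<close> outside. A double integral
  of a kernel built from features becomes an integral of products of single integrals, where
  positive definiteness is visible.\<close>

lemma nn_integral_product_features:
  fixes f :: "'a \<Rightarrow> 'p \<Rightarrow> ennreal" and g :: "'b \<Rightarrow> 'p \<Rightarrow> ennreal"
  assumes "sigma_finite_measure M" "sigma_finite_measure N" "sigma_finite_measure Q"
    and f [measurable]: "case_prod f \<in> borel_measurable (M \<Otimes>\<^sub>M Q)"
    and g [measurable]: "case_prod g \<in> borel_measurable (N \<Otimes>\<^sub>M Q)"
  shows "(\<integral>\<^sup>+x. \<integral>\<^sup>+y. \<integral>\<^sup>+p. f x p * g y p \<partial>Q \<partial>N \<partial>M) =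
    (\<integral>\<^sup>+p. (\<integral>\<^sup>+x. f x p \<partial>M) * (\<integral>\<^sup>+y. g y p \<partial>N) \<partial>Q)"
proof -
  interpret M: sigma_finite_measure M by fact
  interpret N: sigma_finite_measure N by fact
  interpret Q: sigma_finite_measure Q by fact
  interpret NQ: pair_sigma_finite N Q ..
  interpret MQ: pair_sigma_finite M Q ..
  have [measurable]: "(\<lambda>(p, y). g y p) \<in> borel_measurable (Q \<Otimes>\<^sub>M N)"
    "(\<lambda>(p, x). f x p) \<in> borel_measurable (Q \<Otimes>\<^sub>M M)"
    using measurable_pair_swap[OF g] measurable_pair_swap[OF f] by (simp_all add: split_def)
  have "(\<integral>\<^sup>+x. \<integral>\<^sup>+y. \<integral>\<^sup>+p. f x p * g y p \<partial>Q \<partial>N \<partial>M) =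
      (\<integral>\<^sup>+x. \<integral>\<^sup>+p. f x p * (\<integral>\<^sup>+y. g y p \<partial>N) \<partial>Q \<partial>M)"
  proof (intro nn_integral_cong)
    fix x assume [measurable]: "x \<in> space M"
    have "(\<integral>\<^sup>+y. \<integral>\<^sup>+p. f x p * g y p \<partial>Q \<partial>N) = (\<integral>\<^sup>+p. \<integral>\<^sup>+y. f x p * g y p \<partial>N \<partial>Q)"
      by (rule NQ.Fubini'[symmetric]) measurable
    also have "\<dots> = (\<integral>\<^sup>+p. f x p * (\<integral>\<^sup>+y. g y p \<partial>N) \<partial>Q)"
      by (intro nn_integral_cong nn_integral_cmult) measurable
    finally show "(\<integral>\<^sup>+y. \<integral>\<^sup>+p. f x p * g y p \<partial>Q \<partial>N) = (\<integral>\<^sup>+p. f x p * (\<integral>\<^sup>+y. g y p \<partial>N) \<partial>Q)" .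
  qed
  also have "\<dots> = (\<integral>\<^sup>+p. \<integral>\<^sup>+x. f x p * (\<integral>\<^sup>+y. g y p \<partial>N) \<partial>M \<partial>Q)"
    by (rule MQ.Fubini'[symmetric]) measurable
  also have "\<dots> = (\<integral>\<^sup>+p. (\<integral>\<^sup>+x. f x p \<partial>M) * (\<integral>\<^sup>+y. g y p \<partial>N) \<partial>Q)"
    by (intro nn_integral_cong nn_integral_multc) measurable
  finally show ?thesis .
qed

text \<open>This is (a - b)^2 \<ge> 0 with the mixed term moved across, which avoids the truncated
  subtraction of \<open>ennreal\<close> and stays meaningful at infinity.\<close>

lemma ennreal_two_mult_le_squares:
  fixes a b :: ennreal
  shows "2 * (a * b) \<le> a * a + b * b"
proof (cases a b rule: ennreal2_cases)
  case (real_real r q)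
  have "2 * (r * q) \<le> r * r + q * q"
    using sum_squares_bound[of r q] by (simp add: power2_eq_square mult.assoc)
  moreover have "2 * (ennreal r * ennreal q) = ennreal (2 * (r * q))"
    using real_real by (simp add: ennreal_mult)
  moreover have "ennreal r * ennreal r + ennreal q * ennreal q = ennreal (r * r + q * q)"
    using real_real by (simp add: ennreal_mult)
  ultimately show ?thesis
    using real_real ennreal_leI by metis
qed (auto simp: ennreal_top_mult ennreal_mult_top)

(* A point of the parameter space is p = (s, u), a length s and the left end u of the
   window (u, u + s]. *)
definition window :: "real \<Rightarrow> real \<times> real \<Rightarrow> ennreal" where
  "window x p = (if snd p < x \<and> x \<le> snd p + fst p then 1 else 0)"

text \<open>The weight s^(-2) is the second derivative of - ln. Tents max(s - t, 0) superposed with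
  it up to \<open>L\<close> therefore form the integral remainder of the first-order Taylor
  expansion of - ln at \<open>L\<close>.\<close>

definition scale_weight :: "real \<Rightarrow> real \<times> real \<Rightarrow> ennreal" where
  "scale_weight L p = (if 0 < fst p \<and> fst p \<le> L then ennreal (1 / (fst p)\<^sup>2) else 0)"

text \<open>The kernel k(|x - y|) of the overview. The weight is attached to one factor so that the
  integrand has the shape \<open>f x p * g y p\<close> of
  \<open>nn_integral_product_features\<close>; values in \<open>ennreal\<close> leave room for
  infinity on the diagonal.\<close>

definition window_kernel :: "real \<Rightarrow> real \<Rightarrow> real \<Rightarrow> ennreal" where
  "window_kernel L x y = (\<integral>\<^sup>+p. (scale_weight L p * window x p) * window y p \<partial>(lborel \<Otimes>\<^sub>M lborel))"

definition window_energy :: "real \<Rightarrow> real measure \<Rightarrow> real measure \<Rightarrow> ennreal" where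
  "window_energy L M N = (\<integral>\<^sup>+x. \<integral>\<^sup>+y. window_kernel L x y \<partial>N \<partial>M)"

lemma measurable_window [measurable]:
  "case_prod window \<in> borel_measurable (borel \<Otimes>\<^sub>M (lborel \<Otimes>\<^sub>M lborel))"
  unfolding window_def by measurable

lemma measurable_scale_weight [measurable]:
  "scale_weight L \<in> borel_measurable (lborel \<Otimes>\<^sub>M lborel)"
  unfolding scale_weight_def by measurable

lemma sigma_finite_lborel_pair:
  "sigma_finite_measure (lborel \<Otimes>\<^sub>M lborel :: (real \<times> real) measure)"
  by (rule sigma_finite_pair_measure) (rule sigma_finite_lborel)+

lemma measurable_window_kernel [measurable]:
  "case_prod (window_kernel L) \<in> borel_measurable (borel \<Otimes>\<^sub>M borel)"
proof -
  interpret sigma_finite_measure "lborel \<Otimes>\<^sub>M lborel :: (real \<times> real) measure"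
    by (rule sigma_finite_lborel_pair)
  show ?thesis
    unfolding window_kernel_def by measurable
qed

text \<open>The inner integrals are the masses that \<open>M\<close> and \<open>N\<close> give to
  the window, so for \<open>M = N\<close> the energy is a weighted integral of squares.\<close>

lemma window_energy_eq:
  assumes "real_distribution M" "real_distribution N"
  shows "window_energy L M N = (\<integral>\<^sup>+p. scale_weight L p * ((\<integral>\<^sup>+x. window x p \<partial>M) * (\<integral>\<^sup>+y. window y p \<partial>N))
    \<partial>(lborel \<Otimes>\<^sub>M lborel))"
proof -
  interpret M: real_distribution M by fact
  interpret N: real_distribution N by fact
  let ?Q = "lborel \<Otimes>\<^sub>M lborel :: (real \<times> real) measure"
  have [measurable]: "case_prod window \<in> borel_measurable (M \<Otimes>\<^sub>M ?Q)"
    "case_prod window \<in> borel_measurable (N \<Otimes>\<^sub>M ?Q)"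
    by (simp_all cong: measurable_cong_sets sets_pair_measure_cong)
  have "window_energy L M N =
      (\<integral>\<^sup>+p. (\<integral>\<^sup>+x. scale_weight L p * window x p \<partial>M) * (\<integral>\<^sup>+y. window y p \<partial>N) \<partial>?Q)"
    unfolding window_energy_def window_kernel_def
    by (rule nn_integral_product_features)
      (auto intro: M.sigma_finite_measure_axioms N.sigma_finite_measure_axioms sigma_finite_lborel_pair)
  also have "\<dots> = (\<integral>\<^sup>+p. scale_weight L p * ((\<integral>\<^sup>+x. window x p \<partial>M) * (\<integral>\<^sup>+y. window y p \<partial>N)) \<partial>?Q)"
    by (intro nn_integral_cong) (simp add: nn_integral_cmult mult.assoc)
  finally show ?thesis .
qed

lemma window_energy_commute:
  assumes "real_distribution M" "real_distribution N"
  shows "window_energy L M N = window_energy L N M"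
  using assms by (simp add: window_energy_eq mult.commute)

text \<open>Positive definiteness: formally the energy of M - N is nonnegative. The additive form
  needs no signed measures and allows infinite energies; it is the pointwise inequality between
  squares, weighted and integrated over all windows.\<close>

lemma window_energy_polarization:
  assumes "real_distribution M" "real_distribution N"
  shows "2 * window_energy L M N \<le> window_energy L M M + window_energy L N N"
proof -
  interpret M: real_distribution M by fact
  interpret N: real_distribution N by fact
  let ?Q = "lborel \<Otimes>\<^sub>M lborel :: (real \<times> real) measure"
  define w where "w = scale_weight L"
  define m where "m = (\<lambda>p. \<integral>\<^sup>+x. window x p \<partial>M)"
  define n where "n = (\<lambda>p. \<integral>\<^sup>+x. window x p \<partial>N)"
  have sw: "(\<lambda>(p, x). window x p) \<in> borel_measurable (?Q \<Otimes>\<^sub>M borel)"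
    using measurable_pair_swap[OF measurable_window] by (simp add: split_def)
  have [measurable]: "w \<in> borel_measurable ?Q" "m \<in> borel_measurable ?Q" "n \<in> borel_measurable ?Q"
    unfolding w_def m_def n_def
    by (auto intro!: M.borel_measurable_nn_integral N.borel_measurable_nn_integral
        simp: sw cong: measurable_cong_sets sets_pair_measure_cong)
  have "2 * window_energy L M N = (\<integral>\<^sup>+p. 2 * (w p * (m p * n p)) \<partial>?Q)"
    by (subst nn_integral_cmult) (simp_all add: window_energy_eq assms w_def m_def n_def)
  also have "\<dots> \<le> (\<integral>\<^sup>+p. w p * (m p * m p) + w p * (n p * n p) \<partial>?Q)"
  proof (intro nn_integral_mono)
    fix p
    show "2 * (w p * (m p * n p)) \<le> w p * (m p * m p) + w p * (n p * n p)"
      using mult_left_mono[OF ennreal_two_mult_le_squares[of "m p" "n p"], of "w p"]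
      by (simp add: distrib_left mult.left_commute)
  qed
  also have "\<dots> = window_energy L M M + window_energy L N N"
    by (subst nn_integral_add) (simp_all add: window_energy_eq assms w_def m_def n_def)
  finally show ?thesis .
qed

section \<open>The window kernel in closed form\<close>

text \<open>For fixed s, the left ends whose window contains both points fill the half-open interval
  from \<open>max x y - s\<close> to \<open>min x y\<close>. Its length is the positive part of s -
  |x - y|, which \<open>ennreal\<close> supplies by truncation.\<close>

lemma window_kernel_eq_scales:
  "window_kernel L x y =
    (\<integral>\<^sup>+s. (if 0 < s \<and> s \<le> L then ennreal (1 / s\<^sup>2) else 0) * ennreal (s - \<bar>x - y\<bar>) \<partial>lborel)"
proof -
  have [measurable]: "window z \<in> borel_measurable (lborel \<Otimes>\<^sub>M lborel)" for z
    unfolding window_def by measurable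
  have "window_kernel L x y =
      (\<integral>\<^sup>+s. \<integral>\<^sup>+u. (scale_weight L (s, u) * window x (s, u)) * window y (s, u) \<partial>lborel \<partial>lborel)"
    unfolding window_kernel_def
    by (rule sigma_finite_measure.nn_integral_fst[OF sigma_finite_lborel, symmetric]) measurable
  also have "\<dots> = (\<integral>\<^sup>+s. (if 0 < s \<and> s \<le> L then ennreal (1 / s\<^sup>2) else 0) * ennreal (s - \<bar>x - y\<bar>) \<partial>lborel)"
  proof (intro nn_integral_cong)
    fix s :: real
    let ?w = "(if 0 < s \<and> s \<le> L then ennreal (1 / s\<^sup>2) else 0)"
    have "(\<integral>\<^sup>+u. (scale_weight L (s, u) * window x (s, u)) * window y (s, u) \<partial>lborel)
        = (\<integral>\<^sup>+u. ?w * indicator {max x y - s..<min x y} u \<partial>lborel)"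
      by (intro nn_integral_cong) (auto simp: scale_weight_def window_def indicator_def)
    also have "\<dots> = ?w * emeasure lborel {max x y - s..<min x y}"
      by (rule nn_integral_cmult_indicator) simp
    also have "emeasure lborel {max x y - s..<min x y} = ennreal (s - \<bar>x - y\<bar>)"
    proof (cases "max x y - s \<le> min x y")
      case True
      then show ?thesis
        by (auto intro!: arg_cong[where f = ennreal])
    next
      case False
      then show ?thesis
        by (auto simp: ennreal_neg)
    qed
    finally show "(\<integral>\<^sup>+u. (scale_weight L (s, u) * window x (s, u)) * window y (s, u) \<partial>lborel)
        = ?w * ennreal (s - \<bar>x - y\<bar>)" .
  qed
  finally show ?thesis .
qed

text \<open>Only scales s in [t, L] contribute. There the integrand is 1/s - t/s^2, with
  antiderivative ln s + t/s.\<close>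

lemma window_kernel_off_diagonal:
  assumes "x \<noteq> y" "\<bar>x - y\<bar> \<le> L"
  shows "window_kernel L x y = ennreal (ln L - 1 + \<bar>x - y\<bar> / L - ln \<bar>x - y\<bar>)"
proof -
  define t where "t = \<bar>x - y\<bar>"
  have t: "0 < t" "t \<le> L"
    using assms by (auto simp: t_def)
  have "window_kernel L x y = (\<integral>\<^sup>+s. ennreal (1 / s - t / s\<^sup>2) * indicator {t..L} s \<partial>lborel)"
    unfolding window_kernel_eq_scales t_def[symmetric]
  proof (intro nn_integral_cong)
    fix s :: real
    show "(if 0 < s \<and> s \<le> L then ennreal (1 / s\<^sup>2) else 0) * ennreal (s - t) =
        ennreal (1 / s - t / s\<^sup>2) * indicator {t..L} s"
    proof (cases "t \<le> s \<and> s \<le> L")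
      case True
      then have "1 / s\<^sup>2 * (s - t) = 1 / s - t / s\<^sup>2"
        using t by (simp add: field_simps power2_eq_square)
      then show ?thesis
        using True t by (simp add: ennreal_mult[symmetric])
    next
      case False
      then show ?thesis
        using t by (auto simp: indicator_def ennreal_neg)
    qed
  qed
  also have "\<dots> = ennreal ((ln L + t / L) - (ln t + t / t))"
  proof (rule nn_integral_FTC_Icc)
    fix s assume "s \<in> {t..L}"
    then have s: "t \<le> s" "s \<le> L"
      by auto
    then show "((\<lambda>s. ln s + t / s) has_real_derivative 1 / s - t / s\<^sup>2) (at s)"
      using t by (auto intro!: derivative_eq_intros simp: power2_eq_square)
    show "0 \<le> 1 / s - t / s\<^sup>2"
      using t s by (simp add: field_simps power2_eq_square)
  qed (use t in auto)
  also have "(ln L + t / L) - (ln t + t / t) = ln L - 1 + t / L - ln t"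
    using t by simp
  finally show ?thesis
    by (simp add: t_def)
qed

text \<open>The value at coinciding points dominates the values at nearby pairs, and these grow
  without bound as the distance tends to 0.\<close>

lemma window_kernel_diagonal:
  assumes "0 < L"
  shows "window_kernel L x x = \<infinity>"
proof (rule ccontr)
  assume "window_kernel L x x \<noteq> \<infinity>"
  then obtain r where r: "0 \<le> r" "window_kernel L x x = ennreal r"
    by (cases "window_kernel L x x") auto
  \<comment> \<open>At this distance the closed form equals r + 1 + t/L, which exceeds the supposed
    value r. Since r \<ge> 0, the distance stays within \<open>L\<close>, as the closed form
    requires.\<close>
  define t where "t = L * exp (- (r + 2))"
  have t: "0 < t" "t \<le> L"
    using assms r by (auto simp: t_def)
  have "ennreal (ln L - 1 + t / L - ln t) = window_kernel L x (x + t)"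
    using t window_kernel_off_diagonal[of x "x + t" L] by simp
  also have "\<dots> \<le> window_kernel L x x"
    unfolding window_kernel_eq_scales
    by (intro nn_integral_mono mult_left_mono ennreal_leI) auto
  finally have "ln L - 1 + t / L - ln t \<le> r"
    using r by simp
  moreover have "ln t = ln L - (r + 2)"
    using assms by (simp add: t_def ln_mult)
  ultimately show False
    using divide_pos_pos[OF t(1) assms] by simp
qed

text \<open>Splits the logarithm into a bounded real part minus a nonnegative kernel, the shape that
  \<open>ereal_integral_diff\<close> integrates. On the diagonal both sides are minus
  infinity.\<close>

lemma ereal_ln_eq_window_kernel:
  assumes "0 < L" "\<bar>x - y\<bar> \<le> L"
  shows "ereal_ln \<bar>x - y\<bar> = ereal (ln L - 1 + \<bar>x - y\<bar> / L) - enn2ereal (window_kernel L x y)"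
proof (cases "x = y")
  case True
  then show ?thesis
    using assms by (simp add: ereal_ln_def window_kernel_diagonal)
next
  case False
  define t where "t = \<bar>x - y\<bar> / L"
  have t: "0 < t" "\<bar>x - y\<bar> = L * t"
    using False assms by (auto simp: t_def)
  \<comment> \<open>This makes the closed form of the kernel nonnegative, so \<open>ennreal\<close>
    does not truncate it.\<close>
  have "ln t \<le> t - 1"
    using t by (intro ln_le_minus_one)
  then have "0 \<le> ln L - 1 + \<bar>x - y\<bar> / L - ln \<bar>x - y\<bar>"
    using t assms by (simp add: ln_mult)
  then show ?thesis
    using False assms by (simp add: ereal_ln_def window_kernel_off_diagonal)
qed

section \<open>The quantile coupling and distribution functions\<close>

text \<open>Layer-cake form of the distance: the levels u with exactly one of the two points at or
  below u form a half-open interval of length |x - y|. It serves both the transport cost and the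
  mean distance of independent samples.\<close>

lemma nn_integral_separates:
  "(\<integral>\<^sup>+u. indicator {..u} x * indicator {u<..} y + indicator {..u} y * indicator {u<..} x \<partial>lborel)
    = ennreal \<bar>x - y\<bar>" for x y :: real
proof -
  have "(\<integral>\<^sup>+u. indicator {..u} x * indicator {u<..} y + indicator {..u} y * indicator {u<..} x \<partial>lborel)
    = (\<integral>\<^sup>+u. indicator {min x y..<max x y} u \<partial>lborel)"
    by (intro nn_integral_cong) (auto simp: indicator_def)
  also have "\<dots> = ennreal \<bar>x - y\<bar>"
    by (auto simp: min_def max_def)
  finally show ?thesis .
qed

text \<open>The pseudo-inverses \<open>M.I\<close> and \<open>N.I\<close>, driven by the same
  uniform variable, couple \<open>M\<close> and \<open>N\<close>. By Tonelli the cost of this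
  coupling is the integral over u of the probability that u separates the two quantiles.\<close>

lemma W1_le_cdf_distance:
  assumes "real_distribution M" "real_distribution N"
  shows "W1 M N \<le> (\<integral>\<^sup>+u. ennreal \<bar>cdf M u - cdf N u\<bar> \<partial>lborel)"
proof -
  interpret M: cdf_distribution M
    unfolding cdf_distribution_def by fact
  interpret N: cdf_distribution N
    unfolding cdf_distribution_def by fact
  let ?\<Omega> = "restrict_space lborel {0<..<1::real} :: real measure"
  have "prob_space ?\<Omega>"
    by (auto simp: emeasure_restrict_space space_restrict_space intro!: prob_spaceI)
  then interpret \<Omega>: prob_space ?\<Omega> .
  have P: "pair_sigma_finite lborel ?\<Omega>"
    by (intro pair_sigma_finite.intro sigma_finite_lborel \<Omega>.sigma_finite_measure_axioms)
  have [measurable]: "M.I \<in> borel_measurable ?\<Omega>" "N.I \<in> borel_measurable ?\<Omega>"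
    using M.measurable_CI N.measurable_CI
    by (simp_all only: measurable_cong_sets[OF sets_restrict_space_cong[OF sets_lborel] refl])
  let ?\<pi> = "distr ?\<Omega> borel (\<lambda>\<omega>. (M.I \<omega>, N.I \<omega>))"
  have [measurable]: "(\<lambda>\<omega>. (M.I \<omega>, N.I \<omega>)) \<in> measurable ?\<Omega> borel"
    by (subst borel_prod[symmetric]) measurable
  have [measurable]: "(fst :: real \<times> real \<Rightarrow> real) \<in> borel_measurable borel"
    "(snd :: real \<times> real \<Rightarrow> real) \<in> borel_measurable borel"
    by (auto intro!: borel_measurable_continuous_onI continuous_intros)
  have "?\<pi> \<in> couplings M N"
    by (simp add: couplings_def distr_distr comp_def M.distr_I_eq_M N.distr_I_eq_M)
  then have "W1 M N \<le> (\<integral>\<^sup>+p. ennreal \<bar>fst p - snd p\<bar> \<partial>?\<pi>)"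
    unfolding W1_def by (rule INF_lower)
  also have "\<dots> = (\<integral>\<^sup>+\<omega>. ennreal \<bar>M.I \<omega> - N.I \<omega>\<bar> \<partial>?\<Omega>)"
    by (subst nn_integral_distr) auto
  also have "\<dots> = (\<integral>\<^sup>+\<omega>. \<integral>\<^sup>+u. indicator {..u} (M.I \<omega>) * indicator {u<..} (N.I \<omega>)
      + indicator {..u} (N.I \<omega>) * indicator {u<..} (M.I \<omega>) \<partial>lborel \<partial>?\<Omega>)"
    by (simp only: nn_integral_separates)
  also have "\<dots> = (\<integral>\<^sup>+u. \<integral>\<^sup>+\<omega>. indicator {..u} (M.I \<omega>) * indicator {u<..} (N.I \<omega>)
      + indicator {..u} (N.I \<omega>) * indicator {u<..} (M.I \<omega>) \<partial>?\<Omega> \<partial>lborel)"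
    unfolding indicator_def atMost_iff greaterThan_iff by (rule pair_sigma_finite.Fubini'[OF P]) measurable
  also have "\<dots> = (\<integral>\<^sup>+u. ennreal \<bar>cdf M u - cdf N u\<bar> \<partial>lborel)"
  proof (intro nn_integral_cong)
    fix u :: real
    have b: "0 \<le> cdf M u" "cdf M u \<le> 1" "0 \<le> cdf N u" "cdf N u \<le> 1"
      by (auto simp: M.cdf_nonneg N.cdf_nonneg M.cdf_bounded_prob N.cdf_bounded_prob)
    \<comment> \<open>On (0, 1) the quantile \<open>M.I \<omega>\<close> is at most u iff \<omega>
      is at most \<open>cdf M u\<close>. The level u therefore separates the quantiles exactly when
      \<omega> lies between the two distribution function values.\<close>
    have "(\<integral>\<^sup>+\<omega>. indicator {..u} (M.I \<omega>) * indicator {u<..} (N.I \<omega>)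
      + indicator {..u} (N.I \<omega>) * indicator {u<..} (M.I \<omega>) \<partial>?\<Omega>)
      = (\<integral>\<^sup>+\<omega>. indicator {min (cdf M u) (cdf N u)<..max (cdf M u) (cdf N u)} \<omega> * indicator {0<..<1} \<omega> \<partial>lborel)"
      by (subst nn_integral_restrict_space)
        (auto intro!: nn_integral_cong simp: indicator_def M.pseudoinverse[symmetric]
           N.pseudoinverse[symmetric] not_le[symmetric])
    \<comment> \<open>The interval lies in (0, 1], so dropping the restriction to (0, 1) can only
      add the null point 1.\<close>
    also have "\<dots> = (\<integral>\<^sup>+\<omega>. indicator {min (cdf M u) (cdf N u)<..max (cdf M u) (cdf N u)} \<omega> \<partial>lborel)"
      using b by (intro nn_integral_cong_AE eventually_mono[OF AE_lborel_singleton[of 1]])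
        (auto simp: indicator_def)
    also have "\<dots> = ennreal \<bar>cdf M u - cdf N u\<bar>"
      by (auto simp: min_def max_def)
    finally show "(\<integral>\<^sup>+\<omega>. indicator {..u} (M.I \<omega>) * indicator {u<..} (N.I \<omega>)
      + indicator {..u} (N.I \<omega>) * indicator {u<..} (M.I \<omega>) \<partial>?\<Omega>) = ennreal \<bar>cdf M u - cdf N u\<bar>" .
  qed
  finally show ?thesis .
qed

section \<open>Mean distance of independent samples\<close>

text \<open>The expectation of |X - Y| for independent X and Y, as in the energy distance. It
  carries the |x - y| term of the logarithmic energy.\<close>

definition mean_gap :: "real measure \<Rightarrow> real measure \<Rightarrow> ennreal" where
  "mean_gap M N = (\<integral>\<^sup>+x. \<integral>\<^sup>+y. ennreal \<bar>x - y\<bar> \<partial>N \<partial>M)"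

text \<open>A level u separates two independent samples when one is at or below u and the other
  above; the integrand is the probability of this event.\<close>

lemma mean_gap_eq_cdf:
  assumes "real_distribution M" "real_distribution N"
  shows "mean_gap M N =
    (\<integral>\<^sup>+u. ennreal (cdf M u * (1 - cdf N u) + cdf N u * (1 - cdf M u)) \<partial>lborel)"
proof -
  interpret M: real_distribution M by fact
  interpret N: real_distribution N by fact
  let ?below = "\<lambda>x u :: real. (if x \<le> u then 1 else 0) :: ennreal"
  let ?above = "\<lambda>x u :: real. (if u < x then 1 else 0) :: ennreal"
  have meas: "case_prod ?below \<in> borel_measurable (K \<Otimes>\<^sub>M lborel)"
    "case_prod ?above \<in> borel_measurable (K \<Otimes>\<^sub>M lborel)"
    if "sets K = sets borel" for K :: "real measure"
  proof -
    have "case_prod ?below \<in> borel_measurable (borel \<Otimes>\<^sub>M lborel)"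
      "case_prod ?above \<in> borel_measurable (borel \<Otimes>\<^sub>M lborel)"
      by measurable
    then show "case_prod ?below \<in> borel_measurable (K \<Otimes>\<^sub>M lborel)"
      "case_prod ?above \<in> borel_measurable (K \<Otimes>\<^sub>M lborel)"
      by (simp_all only: measurable_cong_sets[OF sets_pair_measure_cong[OF that refl] refl])
  qed
  note [measurable] = meas[OF M.events_eq_borel] meas[OF N.events_eq_borel]
  have below: "(\<integral>\<^sup>+x. ?below x u \<partial>K) = ennreal (cdf K u)"
    and above: "(\<integral>\<^sup>+x. ?above x u \<partial>K) = ennreal (1 - cdf K u)"
    if "real_distribution K" for K u
  proof -
    interpret K: real_distribution K by fact
    have "(\<integral>\<^sup>+x. ?below x u \<partial>K) = (\<integral>\<^sup>+x. indicator {..u} x \<partial>K)"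
      by (intro nn_integral_cong) (auto simp: indicator_def)
    then show "(\<integral>\<^sup>+x. ?below x u \<partial>K) = ennreal (cdf K u)"
      by (simp add: cdf_def K.emeasure_eq_measure)
    have "(\<integral>\<^sup>+x. ?above x u \<partial>K) = (\<integral>\<^sup>+x. indicator (space K - {..u}) x \<partial>K)"
      by (intro nn_integral_cong) (auto simp: indicator_def)
    then show "(\<integral>\<^sup>+x. ?above x u \<partial>K) = ennreal (1 - cdf K u)"
      using K.prob_compl[of "{..u}"] by (simp add: cdf_def K.emeasure_eq_measure)
  qed
  have "mean_gap M N =
      (\<integral>\<^sup>+x. \<integral>\<^sup>+y. \<integral>\<^sup>+u. ?below x u * ?above y u + ?above x u * ?below y u \<partial>lborel \<partial>N \<partial>M)"
    unfolding mean_gap_def nn_integral_separates[symmetric]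
    by (intro nn_integral_cong) (auto simp: indicator_def)
  also have "\<dots> = (\<integral>\<^sup>+x. \<integral>\<^sup>+y. (\<integral>\<^sup>+u. ?below x u * ?above y u \<partial>lborel)
      + (\<integral>\<^sup>+u. ?above x u * ?below y u \<partial>lborel) \<partial>N \<partial>M)"
    by (intro nn_integral_cong nn_integral_add) measurable
  also have "\<dots> = (\<integral>\<^sup>+x. (\<integral>\<^sup>+y. \<integral>\<^sup>+u. ?below x u * ?above y u \<partial>lborel \<partial>N)
      + (\<integral>\<^sup>+y. \<integral>\<^sup>+u. ?above x u * ?below y u \<partial>lborel \<partial>N) \<partial>M)"
    by (intro nn_integral_cong nn_integral_add) measurable
  also have "\<dots> = (\<integral>\<^sup>+x. \<integral>\<^sup>+y. \<integral>\<^sup>+u. ?below x u * ?above y u \<partial>lborel \<partial>N \<partial>M)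
      + (\<integral>\<^sup>+x. \<integral>\<^sup>+y. \<integral>\<^sup>+u. ?above x u * ?below y u \<partial>lborel \<partial>N \<partial>M)"
    by (intro nn_integral_add) measurable
  \<comment> \<open>Each of the two terms is a product kernel with the level u as its parameter, so
    its triple integral factors level by level.\<close>
  also have "(\<integral>\<^sup>+x. \<integral>\<^sup>+y. \<integral>\<^sup>+u. ?below x u * ?above y u \<partial>lborel \<partial>N \<partial>M) =
      (\<integral>\<^sup>+u. ennreal (cdf M u) * ennreal (1 - cdf N u) \<partial>lborel)"
    by (subst nn_integral_product_features)
      (auto simp: below above assms M.sigma_finite_measure_axioms N.sigma_finite_measure_axioms
        sigma_finite_lborel meas)
  also have "(\<integral>\<^sup>+x. \<integral>\<^sup>+y. \<integral>\<^sup>+u. ?above x u * ?below y u \<partial>lborel \<partial>N \<partial>M) =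
      (\<integral>\<^sup>+u. ennreal (1 - cdf M u) * ennreal (cdf N u) \<partial>lborel)"
    by (subst nn_integral_product_features)
      (auto simp: below above assms M.sigma_finite_measure_axioms N.sigma_finite_measure_axioms
        sigma_finite_lborel meas)
  also have "(\<integral>\<^sup>+u. ennreal (cdf M u) * ennreal (1 - cdf N u) \<partial>lborel) +
      (\<integral>\<^sup>+u. ennreal (1 - cdf M u) * ennreal (cdf N u) \<partial>lborel) =
      (\<integral>\<^sup>+u. ennreal (cdf M u) * ennreal (1 - cdf N u)
        + ennreal (1 - cdf M u) * ennreal (cdf N u) \<partial>lborel)"
  proof (rule nn_integral_add[symmetric])
    have [measurable]: "cdf M \<in> borel_measurable borel" "cdf N \<in> borel_measurable borel"
      by (auto intro!: borel_measurable_mono monoI M.cdf_nondecreasing N.cdf_nondecreasing)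
    show "(\<lambda>u. ennreal (cdf M u) * ennreal (1 - cdf N u)) \<in> borel_measurable lborel"
      "(\<lambda>u. ennreal (1 - cdf M u) * ennreal (cdf N u)) \<in> borel_measurable lborel"
      by measurable
  qed
  also have "\<dots> = (\<integral>\<^sup>+u. ennreal (cdf M u * (1 - cdf N u) + cdf N u * (1 - cdf M u)) \<partial>lborel)"
    by (intro nn_integral_cong)
      (simp add: ennreal_mult[symmetric] ennreal_plus[symmetric] M.cdf_nonneg N.cdf_nonneg
        M.cdf_bounded_prob N.cdf_bounded_prob mult.commute del: ennreal_plus)
  finally show ?thesis .
qed

text \<open>Pointwise, with a and b the two distribution function values, a(1 - b) + b(1 - a) = a(1
  - a) + b(1 - b) + (a - b)^2. This makes - |x - y| contribute twice the squared L2 distance of the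
  distribution functions.\<close>

lemma mean_gap_polarization:
  assumes "real_distribution M" "real_distribution N"
  shows "2 * mean_gap M N = mean_gap M M + mean_gap N N
    + 2 * (\<integral>\<^sup>+u. ennreal ((cdf M u - cdf N u)\<^sup>2) \<partial>lborel)"
proof -
  interpret M: real_distribution M by fact
  interpret N: real_distribution N by fact
  have [measurable]: "cdf M \<in> borel_measurable borel" "cdf N \<in> borel_measurable borel"
    by (auto intro!: borel_measurable_mono monoI M.cdf_nondecreasing N.cdf_nondecreasing)
  let ?j = "\<lambda>a b :: real. a * (1 - b) + b * (1 - a)"
  \<comment> \<open>Nonnegativity of each term lets the real identity pass through
    \<open>ennreal\<close> without truncation.\<close>
  have nonneg: "0 \<le> ?j (cdf K u) (cdf K' u)"
    if "K \<in> {M, N}" "K' \<in> {M, N}" for K K' u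
    using that by (auto intro!: add_nonneg_nonneg mult_nonneg_nonneg
        simp: M.cdf_nonneg N.cdf_nonneg M.cdf_bounded_prob N.cdf_bounded_prob)
  have "2 * mean_gap M N = (\<integral>\<^sup>+u. 2 * ennreal (?j (cdf M u) (cdf N u)) \<partial>lborel)"
    by (subst nn_integral_cmult) (simp_all add: mean_gap_eq_cdf assms)
  also have "\<dots> = (\<integral>\<^sup>+u. (ennreal (?j (cdf M u) (cdf M u)) + ennreal (?j (cdf N u) (cdf N u)))
      + 2 * ennreal ((cdf M u - cdf N u)\<^sup>2) \<partial>lborel)"
  proof (intro nn_integral_cong)
    fix u
    have "2 * ?j (cdf M u) (cdf N u) = ?j (cdf M u) (cdf M u) + ?j (cdf N u) (cdf N u)
        + 2 * (cdf M u - cdf N u)\<^sup>2"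
      by (simp add: algebra_simps power2_eq_square)
    moreover have "2 * ennreal r = ennreal (2 * r)" if "0 \<le> r" for r
      using that by (simp add: ennreal_mult)
    ultimately show "2 * ennreal (?j (cdf M u) (cdf N u)) =
        (ennreal (?j (cdf M u) (cdf M u)) + ennreal (?j (cdf N u) (cdf N u)))
        + 2 * ennreal ((cdf M u - cdf N u)\<^sup>2)"
      using nonneg[of M M u] nonneg[of N N u] nonneg[of M N u]
      by (simp only: insertI1 insertI2 simp_thms ennreal_plus[symmetric] zero_le_power2 add_nonneg_nonneg
          zero_le_mult_iff zero_le_numeral)
  qed
  also have "\<dots> = mean_gap M M + mean_gap N N
      + 2 * (\<integral>\<^sup>+u. ennreal ((cdf M u - cdf N u)\<^sup>2) \<partial>lborel)"
    by (simp add: nn_integral_add nn_integral_cmult mean_gap_eq_cdf assms)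
  finally show ?thesis .
qed

section \<open>Estimates for measures on a bounded interval\<close>

text \<open>Cauchy-Schwarz against the indicator of \<open>{a..b}\<close>, which can be inserted
  freely because \<open>h\<close> vanishes elsewhere.\<close>

lemma nn_integral_square_le_Icc:
  fixes h :: "real \<Rightarrow> real"
  assumes [measurable]: "h \<in> borel_measurable borel" and "\<And>u. u \<notin> {a..b} \<Longrightarrow> h u = 0" and "a \<le> b"
  shows "(\<integral>\<^sup>+u. ennreal \<bar>h u\<bar> \<partial>lborel)\<^sup>2 \<le> ennreal (b - a) * (\<integral>\<^sup>+u. ennreal ((h u)\<^sup>2) \<partial>lborel)"
proof -
  have "(\<integral>\<^sup>+u. ennreal \<bar>h u\<bar> \<partial>lborel)\<^sup>2 = (\<integral>\<^sup>+u. indicator {a..b} u * ennreal \<bar>h u\<bar> \<partial>lborel)\<^sup>2"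
    using assms(2) by (intro arg_cong[where f = "\<lambda>x. x\<^sup>2"] nn_integral_cong) (auto simp: indicator_def)
  also have "\<dots> \<le> (\<integral>\<^sup>+u. (indicator {a..b} u)\<^sup>2 \<partial>lborel) * (\<integral>\<^sup>+u. (ennreal \<bar>h u\<bar>)\<^sup>2 \<partial>lborel)"
    by (rule Cauchy_Schwarz_nn_integral) measurable
  also have "(\<integral>\<^sup>+u. (indicator {a..b} u)\<^sup>2 \<partial>lborel) = (\<integral>\<^sup>+u. indicator {a..b} u \<partial>lborel)"
    by (intro nn_integral_cong) (auto simp: indicator_def)
  also have "\<dots> = ennreal (b - a)"
    using assms(3) by simp
  finally show ?thesis
    by (simp add: ennreal_power)
qed

lemma nn_integral_pair_real:
  assumes "real_distribution M" "real_distribution N"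
    and "case_prod f \<in> borel_measurable (borel \<Otimes>\<^sub>M borel)"
  shows "(\<integral>\<^sup>+p. f (fst p) (snd p) \<partial>(M \<Otimes>\<^sub>M N)) = (\<integral>\<^sup>+x. \<integral>\<^sup>+y. f x y \<partial>N \<partial>M)"
proof -
  interpret M: real_distribution M by fact
  interpret N: real_distribution N by fact
  have "case_prod f \<in> borel_measurable (M \<Otimes>\<^sub>M N)"
    using assms(3) by (simp only: measurable_cong_sets
        [OF sets_pair_measure_cong[OF M.events_eq_borel N.events_eq_borel] refl])
  from N.nn_integral_fst[OF this] show ?thesis
    by (simp add: split_def)
qed

lemma mean_gap_finite:
  assumes "real_distribution M" "real_distribution N"
    and "AE x in M. \<bar>x\<bar> \<le> R" "AE y in N. \<bar>y\<bar> \<le> R"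
  shows "mean_gap M N \<noteq> \<infinity>"
proof -
  interpret M: real_distribution M by fact
  interpret N: real_distribution N by fact
  have "mean_gap M N \<le> (\<integral>\<^sup>+x. \<integral>\<^sup>+y. ennreal (2 * R) \<partial>N \<partial>M)"
    unfolding mean_gap_def
    using assms(3)
  proof (intro nn_integral_mono_AE, eventually_elim)
    case (elim x)
    show ?case
      using assms(4) elim by (intro nn_integral_mono_AE) (auto elim!: eventually_mono intro!: ennreal_leI)
  qed
  also have "\<dots> = ennreal (2 * R)"
    by (simp add: M.emeasure_space_1[simplified] N.emeasure_space_1[simplified])
  finally show ?thesis
    by (auto simp: top_unique)
qed

text \<open>Two points of [-R, R] are at distance at most 2 R, so the splitting of the logarithm
  with L = 2 R holds almost everywhere for the product measure. Its real part is bounded, hence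
  integrable, and only the window energy may be infinite.\<close>

lemma log_integral_eq_window_energy:
  assumes M: "real_distribution M" and N: "real_distribution N" and R: "0 < R"
    and bounded: "AE x in M. \<bar>x\<bar> \<le> R" "AE y in N. \<bar>y\<bar> \<le> R"
  shows "log_integral M N = ereal (ln (2 * R) - 1 + enn2real (mean_gap M N) / (2 * R))
    - enn2ereal (window_energy (2 * R) M N)"
proof -
  interpret M: real_distribution M by fact
  interpret N: real_distribution N by fact
  interpret P: pair_prob_space M N ..
  let ?P = "M \<Otimes>\<^sub>M N"
  note cong = measurable_cong_sets[OF sets_pair_measure_cong[OF M.events_eq_borel N.events_eq_borel] refl]
  have dist [measurable]: "(\<lambda>p. \<bar>fst p - snd p\<bar>) \<in> borel_measurable ?P"
    unfolding cong by measurable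
  have kernel: "(\<lambda>p. window_kernel (2 * R) (fst p) (snd p)) \<in> borel_measurable ?P"
    unfolding cong by measurable
  have close: "AE p in ?P. \<bar>fst p - snd p\<bar> \<le> 2 * R"
  proof (rule P.AE_pair_measure)
    show "{p \<in> space ?P. \<bar>fst p - snd p\<bar> \<le> 2 * R} \<in> sets ?P"
      by measurable
    show "AE x in M. AE y in N. \<bar>fst (x, y) - snd (x, y)\<bar> \<le> 2 * R"
      using bounded(1)
    proof eventually_elim
      case (elim x)
      show ?case
        using bounded(2) elim by (auto elim!: eventually_mono)
    qed
  qed
  have int: "integrable ?P (\<lambda>p. \<bar>fst p - snd p\<bar>)"
    using close dist by (intro P.integrable_const_bound[where B = "2 * R"]) simp_all
  have "(\<integral>p. \<bar>fst p - snd p\<bar> \<partial>?P) = enn2real (mean_gap M N)"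
    unfolding mean_gap_def
    by (subst nn_integral_pair_real[OF M N, symmetric])
      (use dist in \<open>auto intro!: integral_eq_nn_integral\<close>)
  then have "(\<integral>p. ln (2 * R) - 1 + \<bar>fst p - snd p\<bar> / (2 * R) \<partial>?P) =
      ln (2 * R) - 1 + enn2real (mean_gap M N) / (2 * R)"
    using int by (simp add: P.prob_space)
  moreover have "log_integral M N = ereal (\<integral>p. ln (2 * R) - 1 + \<bar>fst p - snd p\<bar> / (2 * R) \<partial>?P)
      - enn2ereal (\<integral>\<^sup>+p. window_kernel (2 * R) (fst p) (snd p) \<partial>?P)"
    unfolding log_integral_def
  proof (rule ereal_integral_diff)
    show "integrable ?P (\<lambda>p. ln (2 * R) - 1 + \<bar>fst p - snd p\<bar> / (2 * R))"
      using int by simp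
    show "AE p in ?P. (case p of (x, y) \<Rightarrow> ereal_ln \<bar>x - y\<bar>) =
        ereal (ln (2 * R) - 1 + \<bar>fst p - snd p\<bar> / (2 * R)) - enn2ereal (window_kernel (2 * R) (fst p) (snd p))"
      using close
    proof eventually_elim
      case (elim p)
      then show ?case
        using R ereal_ln_eq_window_kernel[of "2 * R" "fst p" "snd p"] by (simp add: split_def)
    qed
  qed (rule kernel)
  moreover have "(\<integral>\<^sup>+p. window_kernel (2 * R) (fst p) (snd p) \<partial>?P) = window_energy (2 * R) M N"
    unfolding window_energy_def by (rule nn_integral_pair_real[OF M N measurable_window_kernel])
  ultimately show ?thesis
    by simp
qed

text \<open>Integrating the splitting of the logarithm in one variable shows that the potential of
  the window kernel is the logarithmic potential plus the mean of a bounded function.\<close>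

lemma window_potential_le:
  assumes M: "real_distribution M" and R: "0 < R" "AE y in M. \<bar>y\<bar> \<le> R" "\<bar>x\<bar> \<le> R"
    and C: "log_potential M (of_real x) \<le> ereal C"
  shows "(\<integral>\<^sup>+y. window_kernel (2 * R) x y \<partial>M) \<le> ennreal (C + ln (2 * R))"
proof -
  interpret M: real_distribution M by fact
  let ?g = "\<lambda>y. ln (2 * R) - 1 + \<bar>x - y\<bar> / (2 * R)"
  have close: "AE y in M. \<bar>x - y\<bar> \<le> 2 * R"
    using R(2) by eventually_elim (use R(3) in auto)
  have [measurable]: "window_kernel (2 * R) x \<in> borel_measurable borel"
    using measurable_compose[OF measurable_Pair1' measurable_window_kernel] by simp
  have "integrable M (\<lambda>y. \<bar>x - y\<bar>)"
    using close by (intro M.integrable_const_bound[where B = "2 * R"]) simp_all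
  then have g: "integrable M ?g"
    by simp
  \<comment> \<open>Since |x - y| \<le> 2 R, the term - 1 + |x - y| / (2 R) is at most 0.\<close>
  have "(\<integral>y. ?g y \<partial>M) \<le> (\<integral>y. ln (2 * R) \<partial>M)"
    using g close R(1) by (intro integral_mono_AE) (auto elim!: eventually_mono simp: field_simps)
  then have g_le: "(\<integral>y. ?g y \<partial>M) \<le> ln (2 * R)"
    using M.prob_space by simp
  have "ereal_integral M (\<lambda>y. ereal_ln (norm (complex_of_real x - complex_of_real y))) =
      ereal (\<integral>y. ?g y \<partial>M) - enn2ereal (\<integral>\<^sup>+y. window_kernel (2 * R) x y \<partial>M)"
  proof (rule ereal_integral_diff[OF g])
    show "AE y in M. ereal_ln (norm (complex_of_real x - complex_of_real y)) =
        ereal (?g y) - enn2ereal (window_kernel (2 * R) x y)"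
      using close
    proof eventually_elim
      case (elim y)
      then show ?case
        using R(1) ereal_ln_eq_window_kernel[of "2 * R" x y]
        by (simp flip: of_real_diff)
    qed
  qed measurable
  then have "- (ereal (\<integral>y. ?g y \<partial>M) - enn2ereal (\<integral>\<^sup>+y. window_kernel (2 * R) x y \<partial>M)) \<le> ereal C"
    using C by (simp add: log_potential_def)
  then show ?thesis
    using g_le by (cases "\<integral>\<^sup>+y. window_kernel (2 * R) x y \<partial>M") (auto intro!: ennreal_leI)
qed

text \<open>Continuity gives a maximum on the compact segment, and finiteness of the potential makes
  that maximum a real number. Both hypotheses on the potential enter the argument through this
  bound.\<close>

lemma log_potential_bounded_above:
  assumes "\<And>z. \<bar>log_potential \<mu> z\<bar> \<noteq> \<infinity>" "continuous_on UNIV (log_potential \<mu>)" "0 < R"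
  shows "\<exists>C. \<forall>x. \<bar>x\<bar> \<le> R \<longrightarrow> log_potential \<mu> (of_real x) \<le> ereal C"
proof -
  let ?K = "complex_of_real ` {-R..R}"
  have "compact ?K"
    by (intro compact_continuous_image continuous_intros) simp
  moreover have "?K \<noteq> {}"
    using assms(3) by simp
  moreover have "continuous_on ?K (log_potential \<mu>)"
    using assms(2) by (rule continuous_on_subset) simp
  ultimately obtain z where z: "\<And>w. w \<in> ?K \<Longrightarrow> log_potential \<mu> w \<le> log_potential \<mu> z"
    using continuous_attains_sup by metis
  obtain C where "log_potential \<mu> z = ereal C"
    using assms(1)[of z] by (cases "log_potential \<mu> z") auto
  then show ?thesis
    using z by (metis abs_le_iff atLeastAtMost_iff imageI minus_le_iff)
qed

text \<open>Ensures that distribution functions of two measures on [-R, R] differ only inside that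
  interval, as the Cauchy-Schwarz step requires.\<close>

lemma cdf_concentrated:
  assumes "real_distribution M" "AE x in M. \<bar>x\<bar> \<le> R" "u \<notin> {-R..R}"
  shows "cdf M u = (if u < -R then 0 else 1)"
proof -
  interpret M: real_distribution M by fact
  show ?thesis
  proof (cases "u < -R")
    case True
    have "AE x in M. x \<notin> {..u}"
      using assms(2) by eventually_elim (use True in auto)
    then show ?thesis
      using True by (simp add: cdf_def M.prob_eq_0)
  next
    case False
    have "AE x in M. x \<in> {..u}"
      using assms(2) by eventually_elim (use False assms(3) in auto)
    then show ?thesis
      using False by (simp add: cdf_def M.prob_eq_1)
  qed
qed

lemma W1_square_le:
  assumes M: "real_distribution M" and N: "real_distribution N" and R: "0 < R"
    and bounded: "AE x in M. \<bar>x\<bar> \<le> R" "AE y in N. \<bar>y\<bar> \<le> R"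
  shows "(W1 M N)\<^sup>2 \<le> ennreal (2 * R) * (\<integral>\<^sup>+u. ennreal ((cdf M u - cdf N u)\<^sup>2) \<partial>lborel)"
proof -
  interpret M: real_distribution M by fact
  interpret N: real_distribution N by fact
  have [measurable]: "cdf M \<in> borel_measurable borel" "cdf N \<in> borel_measurable borel"
    by (auto intro!: borel_measurable_mono monoI M.cdf_nondecreasing N.cdf_nondecreasing)
  have "(W1 M N)\<^sup>2 \<le> (\<integral>\<^sup>+u. ennreal \<bar>cdf M u - cdf N u\<bar> \<partial>lborel)\<^sup>2"
    by (intro power_mono W1_le_cdf_distance M N) simp
  also have "\<dots> \<le> ennreal (R - - R) * (\<integral>\<^sup>+u. ennreal ((cdf M u - cdf N u)\<^sup>2) \<partial>lborel)"
    using R by (intro nn_integral_square_le_Icc)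
      (simp_all add: cdf_concentrated[OF M bounded(1)] cdf_concentrated[OF N bounded(2)])
  also have "R - - R = 2 * R"
    by simp
  finally show ?thesis .
qed

section \<open>The entropy bound and the conclusion\<close>

text \<open>Each of the four logarithmic integrals splits into a constant, a mean gap and a window
  energy. The constants cancel, the mean gaps give the squared L2 distance divided by
  \<open>R\<close>, and the window energies add a nonnegative amount by polarization.\<close>

lemma relative_free_entropy_ge:
  assumes M: "real_distribution M" and N: "real_distribution N" and R: "0 < R"
    and bounded: "AE x in M. \<bar>x\<bar> \<le> R" "AE y in N. \<bar>y\<bar> \<le> R"
    and support: "measure_support N \<subseteq> measure_support M"
    and potential: "\<And>x. \<bar>x\<bar> \<le> R \<Longrightarrow> log_potential M (of_real x) \<le> ereal C"
  shows "enn2ereal (\<integral>\<^sup>+u. ennreal ((cdf N u - cdf M u)\<^sup>2) \<partial>lborel) \<le> ereal R * relative_free_entropy M N"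
proof -
  let ?I = "window_energy (2 * R)" and ?D = "\<integral>\<^sup>+u. ennreal ((cdf N u - cdf M u)\<^sup>2) \<partial>lborel"
  \<comment> \<open>The window potential of \<open>M\<close> is bounded on [-R, R], so every energy
    against \<open>M\<close> is finite. Only the self-energy of \<open>N\<close> can be
    infinite.\<close>
  have finite: "?I K M \<le> ennreal (C + ln (2 * R))"
    if K: "real_distribution K" "AE x in K. \<bar>x\<bar> \<le> R" for K
  proof -
    interpret K: real_distribution K by fact
    have "?I K M \<le> (\<integral>\<^sup>+x. ennreal (C + ln (2 * R)) \<partial>K)"
      unfolding window_energy_def using K(2)
      by (intro nn_integral_mono_AE, eventually_elim)
        (rule window_potential_le[OF M R bounded(1) _ potential])
    also have "\<dots> = ennreal (C + ln (2 * R))"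
      by (simp add: K.emeasure_space_1[simplified])
    finally show ?thesis .
  qed
  obtain i where i: "?I N M = ennreal i" "0 \<le> i"
    using finite[OF N bounded(2)] by (cases "?I N M") (auto simp: top_unique)
  obtain j where j: "?I M M = ennreal j" "0 \<le> j"
    using finite[OF M bounded(1)] by (cases "?I M M") (auto simp: top_unique)
  have "mean_gap N M \<noteq> \<infinity>" "mean_gap N N \<noteq> \<infinity>" "mean_gap M M \<noteq> \<infinity>" "mean_gap M N \<noteq> \<infinity>"
    using mean_gap_finite M N bounded by blast+
  then obtain a b c e where gaps: "mean_gap N M = ennreal a" "0 \<le> a" "mean_gap N N = ennreal b" "0 \<le> b"
    "mean_gap M M = ennreal c" "0 \<le> c" "mean_gap M N = ennreal e" "0 \<le> e"
    by (metis ennreal_cases infinity_ennreal_def)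
  have two: "2 * ennreal r = ennreal (2 * r)" if "0 \<le> r" for r
    using that by (simp add: ennreal_mult)
  \<comment> \<open>Both orders are needed because \<open>mean_gap N M\<close> and
    \<open>mean_gap M N\<close> each occur in the entropy; together they give a + e - b - c = 2
    d.\<close>
  have pol: "2 * mean_gap N M = mean_gap N N + mean_gap M M + 2 * ?D"
    "2 * mean_gap M N = mean_gap M M + mean_gap N N + 2 * ?D"
    using mean_gap_polarization[OF N M] mean_gap_polarization[OF M N] by (simp_all add: power2_commute)
  have "?D \<noteq> \<infinity>"
    using pol(1) gaps by (auto simp: two ennreal_mult_top)
  then obtain d where d: "?D = ennreal d" "0 \<le> d"
    by (cases ?D) auto
  have ad: "2 * a = b + c + 2 * d" "2 * e = b + c + 2 * d"
    using pol gaps d by (simp_all add: two ennreal_plus[symmetric] del: ennreal_plus)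
  have energy: "2 * ?I N M \<le> ?I N N + ?I M M"
    by (rule window_energy_polarization[OF N M])
  have "ereal (d / R) \<le> relative_free_entropy M N"
  proof (cases "?I N N")
    case (real k)
    have "2 * i \<le> k + j"
      using energy i j real by (simp add: two ennreal_plus[symmetric] del: ennreal_plus)
    \<comment> \<open>When all energies are finite the entropy equals (a + e - b - c) / (2 R) + (k +
      j - 2 i), whose second summand is nonnegative.\<close>
    moreover have "d / R = (a + e - b - c) / (2 * R)"
      using ad R by (simp add: field_simps)
    ultimately show ?thesis
      using i j real gaps support R
      by (simp add: relative_free_entropy_def log_integral_eq_window_energy[OF _ _ R] M N bounded
          window_energy_commute[OF M N] diff_divide_distrib add_divide_distrib)
  next
    \<comment> \<open>An infinite self-energy makes the logarithmic integral of \<open>N\<close>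
      minus infinity while the other three stay finite, so the entropy is infinite.\<close>
    case top
    then show ?thesis
      using i j gaps support
      by (simp add: relative_free_entropy_def log_integral_eq_window_energy[OF _ _ R] M N bounded
          window_energy_commute[OF M N])
  qed
  then have "ereal R * ereal (d / R) \<le> ereal R * relative_free_entropy M N"
    using R by (intro ereal_mult_left_mono) simp_all
  then show ?thesis
    using d R by simp
qed

theorem theorem1p4:
  fixes \<mu> :: "real measure"
  assumes "real_distribution \<mu>"
    and "compact (measure_support \<mu>)"
    and "\<And>z. \<bar>log_potential \<mu> z\<bar> \<noteq> \<infinity>"
    and "continuous_on UNIV (log_potential \<mu>)"
  shows "\<exists>B::real. \<forall>\<nu>. real_distribution \<nu> \<longrightarrow>
           (enn2ereal (W1 \<nu> \<mu>))\<^sup>2 \<le> ereal B * relative_free_entropy \<mu> \<nu>"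
proof -
  obtain R where R: "0 < R" "\<forall>x \<in> measure_support \<mu>. norm x \<le> R"
    using compact_imp_bounded[OF assms(2)] unfolding bounded_pos by (elim exE conjE)
  obtain C where C: "\<forall>x. \<bar>x\<bar> \<le> R \<longrightarrow> log_potential \<mu> (of_real x) \<le> ereal C"
    using log_potential_bounded_above[OF assms(3,4) R(1)] by (elim exE)
  \<comment> \<open>A measure is carried by its support, so support inclusion confines \<nu> to the
    same interval as \<mu>.\<close>
  have concentrated: "AE x in K. \<bar>x\<bar> \<le> R"
    if "real_distribution K" "measure_support K \<subseteq> measure_support \<mu>" for K
    using AE_in_measure_support[of K] that R(2)
    by (auto elim!: eventually_mono simp: real_distribution.events_eq_borel)
  \<comment> \<open>The constant is the product of the interval length 2 R from Cauchy-Schwarz and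
    the factor R from the entropy bound.\<close>
  have "(enn2ereal (W1 \<nu> \<mu>))\<^sup>2 \<le> ereal (2 * R\<^sup>2) * relative_free_entropy \<mu> \<nu>"
    if \<nu>: "real_distribution \<nu>" for \<nu>
  proof (cases "measure_support \<nu> \<subseteq> measure_support \<mu>")
    case True
    let ?D = "\<integral>\<^sup>+u. ennreal ((cdf \<nu> u - cdf \<mu> u)\<^sup>2) \<partial>lborel"
    have "(enn2ereal (W1 \<nu> \<mu>))\<^sup>2 = enn2ereal ((W1 \<nu> \<mu>)\<^sup>2)"
      by (simp add: power2_eq_square times_ennreal.rep_eq)
    also have "\<dots> \<le> enn2ereal (ennreal (2 * R) * ?D)"
      using W1_square_le[OF \<nu> assms(1) R(1) concentrated[OF \<nu> True] concentrated[OF assms(1) order_refl]]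
      by (simp add: less_eq_ennreal.rep_eq)
    also have "\<dots> = ereal (2 * R) * enn2ereal ?D"
      using R(1) by (simp add: times_ennreal.rep_eq enn2ereal_ennreal)
    also have "\<dots> \<le> ereal (2 * R) * (ereal R * relative_free_entropy \<mu> \<nu>)"
      using R(1)
      by (intro ereal_mult_left_mono relative_free_entropy_ge[OF assms(1) \<nu> R(1) _ _ True C[rule_format]]
          concentrated \<nu> assms(1) True order_refl) simp_all
    also have "\<dots> = ereal (2 * R\<^sup>2) * relative_free_entropy \<mu> \<nu>"
      by (simp add: mult.assoc[symmetric] power2_eq_square)
    finally show ?thesis .
  next
    \<comment> \<open>Here the entropy is infinite, and since the constant is positive the right
      side is infinite as well.\<close>
    case False
    then show ?thesis
      using R(1) by (simp add: relative_free_entropy_def)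
  qed
  then show ?thesis
    by blast
qed

end
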